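(* Let $(\mathbb{Q},\delta)$ be a proper metric space of densities with respect to some measure on $\mathbb{R}^d$, and let $\delta_{\mathsf L}$ be the intrinsic metric induced by $\delta$. Suppose that $q_1,\dots,q_n\in\mathbb{Q}$ are such that $$\varepsilon_n:=\sup_{q\in\mathbb{Q}}\min_{i\in[n]}\delta(q,q_i)\to0\quad\text{as }n\to\infty,$$ and that $\delta_{\mathsf L}(q,q_0)=\delta(q,q_0)[1+\omega(q,q_0)]$ for all $q,q_0\in\mathbb{Q}$, where $\omega$ is continuous with $\omega(q,q)=0$ for all $q$. Let $\mathcal{S}_1,\dots,\mathcal{S}_n$ be samples from $q_1,\dots,q_n$ respectively, and suppose that based on the samples we produce $(\hat\delta_{ij})$ consistent for $\delta_{ij}:=\delta(q_i,q_j)$, uniformly over $i$ and $j$, in the sense that $$\max_{i\ne j}|\hat\delta_{ij}-\delta_{ij}|/\delta_{ij}\to0\quad\text{in probability as }\min_i|\mathcal{S}_i|\to\infty.$$ Fix $i$ and $j$ such that $\delta_{\mathsf L}(q_i,q_j)<\infty$. Then, with a choice of connectivity radius $r_n\to0$ slowly enough that $\varepsilon_n/r_n\to0$, $\hat d_{ij}$ is consistent for $\delta_{\mathsf L}(q_i,q_j)$, i.e. $\hat d_{ij}\to\delta_{\mathsf L}(q_i,q_j)$ in probability, as $n\to\infty$.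
   Context: A metric space is proper if every closed ball in it is compact. The length of a path (continuous curve) $\gamma:[a,b]\to\mathbb{Q}$ is $$\mathsf L(\gamma)=\sup_{a=t_0<\dots<t_k=b}\ \sum_{i=1}^k\delta(\gamma(t_{i-1}),\gamma(t_i)),$$ and $\delta_{\mathsf L}(q,q')=\inf\{\mathsf L(\gamma):\gamma\text{ connects }q,q'\}$, where $\gamma$ connects $q,q'$ if $\gamma(a)=q$ and $\gamma(b)=q'$. $\hat d_{ij}$ (which depends on $n$ and on the samples) is the shortest-path distance between nodes $i$ and $j$ in the graph with node set $\{1,\dots,n\}$ and edge set $\{(k,l):\hat\delta_{kl}\le r_n\}$, the edge $(k,l)$ having weight $\hat\delta_{kl}$; $(\hat\delta_{kl})$ is nonnegative and symmetric. The $q_i$ are distinct. The asymptotic regime is $n\to\infty$ with the sample sizes allowed to depend on $n$ and such that $\min_{i\le n}|\mathcal{S}_i|\to\infty$, along which $\max_{1\le i\ne j\le n}|\hat\delta_{ij}-\delta_{ij}|/\delta_{ij}\to0$ in probability. $[n]=\{1,\dots,n\}$. *)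

theory Defs
  imports "HOL-Probability.Probability" "Graph_Theory.Shortest_Path"
begin

context Metric_space
begin

definition proper_space :: bool where
  "proper_space \<longleftrightarrow> (\<forall>x\<in>M. \<forall>r. compactin mtopology (mcball x r))"

definition connects :: "real \<Rightarrow> real \<Rightarrow> (real \<Rightarrow> 'a) \<Rightarrow> 'a \<Rightarrow> 'a \<Rightarrow> bool" where
  "connects a b \<gamma> x y \<longleftrightarrow>
     a \<le> b \<and> continuous_map (top_of_set {a..b}) mtopology \<gamma> \<and> \<gamma> a = x \<and> \<gamma> b = y"

text \<open>A subdivision \<open>a = t\<^sub>0 < \<dots> < t\<^sub>k = b\<close> is a pair of \<open>k\<close> and a sequence \<open>t\<close>, whose values
  beyond index \<open>k\<close> are irrelevant.\<close>
definition path_length :: "real \<Rightarrow> real \<Rightarrow> (real \<Rightarrow> 'a) \<Rightarrow> ereal" where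
  "path_length a b \<gamma> =
     (SUP (k, t) \<in> {(k::nat, t::nat \<Rightarrow> real). t 0 = a \<and> t k = b \<and> (\<forall>i<k. t i < t (Suc i))}.
        ereal (\<Sum>i=1..k. d (\<gamma> (t (i - 1))) (\<gamma> (t i))))"

text \<open>The value is \<open>\<infinity>\<close> if no path in the space connects the points, or if all connecting paths
  have infinite length.\<close>
definition intrinsic_dist :: "'a \<Rightarrow> 'a \<Rightarrow> ereal" where
  "intrinsic_dist x y = (INF (a, b, \<gamma>) \<in> {(a, b, \<gamma>). connects a b \<gamma> x y}. path_length a b \<gamma>)"

definition fill_radius :: "(nat \<Rightarrow> 'a) \<Rightarrow> nat \<Rightarrow> ereal" where
  "fill_radius q n = (SUP x\<in>M. ereal (MIN i\<in>{1..n}. d x (q i)))"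

end

definition prob_density :: "'a measure \<Rightarrow> ('a \<Rightarrow> real) \<Rightarrow> bool" where
  "prob_density \<mu> f \<longleftrightarrow>
     f \<in> borel_measurable \<mu> \<and> (\<forall>x\<in>space \<mu>. 0 \<le> f x) \<and> (\<integral>\<^sup>+x. ennreal (f x) \<partial>\<mu>) = 1"

text \<open>Convergence in probability of extended real variables to a constant. The probability space may
  change with \<open>n\<close>. Only finite \<open>c\<close> are meaningful, since \<open>\<infinity> - \<infinity> = \<infinity>\<close> in \<^typ>\<open>ereal\<close>.\<close>
definition tendsto_in_prob ::
  "(nat \<Rightarrow> 'w measure) \<Rightarrow> (nat \<Rightarrow> 'w \<Rightarrow> ereal) \<Rightarrow> ereal \<Rightarrow> bool" where
  "tendsto_in_prob P Y c \<longleftrightarrow>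
     (\<forall>n. Y n \<in> borel_measurable (P n)) \<and>
     (\<forall>e>0. (\<lambda>n. measure (P n) {w \<in> space (P n). ereal e < \<bar>Y n w - c\<bar>}) \<longlonglongrightarrow> 0)"

text \<open>The \<open>l\<close>-th of the \<open>n\<close> samples has size \<open>m n l\<close>; its \<open>k\<close>-th observation is \<open>X n l k\<close>.\<close>
definition sample_index :: "(nat \<Rightarrow> nat \<Rightarrow> nat) \<Rightarrow> nat \<Rightarrow> (nat \<times> nat) set" where
  "sample_index m n = (SIGMA l:{1..n}. {1..m n l})"

definition sample_data ::
  "(nat \<Rightarrow> nat \<Rightarrow> nat) \<Rightarrow> (nat \<Rightarrow> nat \<Rightarrow> nat \<Rightarrow> 'w \<Rightarrow> 'x) \<Rightarrow> nat \<Rightarrow> 'w \<Rightarrow> nat \<times> nat \<Rightarrow> 'x" where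
  "sample_data m X n w = restrict (\<lambda>(l, k). X n l k w) (sample_index m n)"

definition max_rel_error ::
  "nat \<Rightarrow> (nat \<Rightarrow> nat \<Rightarrow> real) \<Rightarrow> (nat \<Rightarrow> nat \<Rightarrow> real) \<Rightarrow> real" where
  "max_rel_error n W D =
     Max {\<bar>W k l - D k l\<bar> / D k l | k l. k \<in> {1..n} \<and> l \<in> {1..n} \<and> k \<noteq> l}"

definition neighborhood_graph ::
  "nat \<Rightarrow> (nat \<Rightarrow> nat \<Rightarrow> real) \<Rightarrow> real \<Rightarrow> (nat, nat \<times> nat) pre_digraph" where
  "neighborhood_graph n W r =
     \<lparr>verts = {1..n}, arcs = {(k, l). k \<in> {1..n} \<and> l \<in> {1..n} \<and> W k l \<le> r}, tail = fst, head = snd\<rparr>"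

lemma wf_neighborhood_graph: "wf_digraph (neighborhood_graph n W r)"
  by unfold_locales (auto simp: neighborhood_graph_def)

text \<open>\<^const>\<open>wf_digraph.\<mu>\<close> is the infimum of the costs of the walks between two nodes; it is
  \<open>\<infinity>\<close> if there are none.\<close>
definition graph_dist ::
  "nat \<Rightarrow> (nat \<Rightarrow> nat \<Rightarrow> real) \<Rightarrow> real \<Rightarrow> nat \<Rightarrow> nat \<Rightarrow> ereal" where
  "graph_dist n W r = wf_digraph.\<mu> (neighborhood_graph n W r) (\<lambda>(k, l). W k l)"

end

theory Submission
  imports Defs
begin

text \<open>
  Fix a tolerance \<open>\<eta>\<close>. On the event that every edge length is estimated with relative error at most
  \<open>\<eta>\<close>, the graph distance and the intrinsic distance \<open>L\<close> of the two given points can be compared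
  deterministically; the hypothesis on the estimator makes the probability of this event tend to one,
  so convergence in probability follows (\<open>tendsto_in_prob_transfer\<close>).

  For the upper bound (\<open>graph_dist_eventually_le\<close>), take a path of length at most \<open>\<Lambda>\<close>, slightly larger
  than \<open>L\<close>. Cutting it whenever it has moved a distance \<open>r/2\<close> gives about \<open>2 \<Lambda> / r\<close> pieces. Replacing
  each cut point by one of the points \<open>q k\<close> within \<open>\<epsilon>\<close> of it costs at most \<open>2 \<epsilon>\<close> per piece, that is, a total
  of order \<open>\<Lambda> \<epsilon> / r\<close>, which is negligible because \<open>\<epsilon> / r\<close> tends to 0. Consecutive replacements are at
  distance at most \<open>r/2 + 2 \<epsilon>\<close>, so that their estimated distance is still below the radius \<open>r\<close>, and
  they form a walk in the graph.

  For the lower bound (\<open>graph_dist_eventually_ge\<close>), consider a walk of cost at most \<open>L\<close>. It stays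
  in a fixed ball, which is compact, and the function \<open>\<omega>\<close> is uniformly small on pairs of nearby points
  there (\<open>small_near_diagonal\<close>). As the arcs are short, the intrinsic distance of the ends of each arc is
  at most \<open>(1 + \<eta>) / (1 - \<eta>)\<close> times the cost of the arc, and the triangle inequality for the intrinsic
  distance bounds \<open>L\<close> by the same multiple of the cost of the walk.

  Suprema over subdivisions are awkward when paths are cut or concatenated. They are replaced by a
  control function \<open>v\<close> with \<open>d (\<gamma> s) (\<gamma> t) \<le> v t - v s\<close>: a path has length at most \<open>A\<close> exactly if it has
  a control function of total increment at most \<open>A\<close>.
\<close>

section \<open>Path length through control functions\<close>

context Metric_space
begin

definition length_control :: "real \<Rightarrow> real \<Rightarrow> (real \<Rightarrow> 'a) \<Rightarrow> (real \<Rightarrow> real) \<Rightarrow> bool" where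
  "length_control a b \<gamma> v \<longleftrightarrow>
     (\<forall>s t. a \<le> s \<longrightarrow> s \<le> t \<longrightarrow> t \<le> b \<longrightarrow> d (\<gamma> s) (\<gamma> t) \<le> v t - v s)"

lemma length_controlD:
  "length_control a b \<gamma> v \<Longrightarrow> a \<le> s \<Longrightarrow> s \<le> t \<Longrightarrow> t \<le> b \<Longrightarrow> d (\<gamma> s) (\<gamma> t) \<le> v t - v s"
  by (simp add: length_control_def)

lemma path_length_le_control:
  assumes v: "length_control a b \<gamma> v"
  shows "path_length a b \<gamma> \<le> ereal (v b - v a)"
proof -
  have "(\<Sum>i=1..k. d (\<gamma> (t (i - 1))) (\<gamma> (t i))) \<le> v b - v a"
    if t: "t 0 = a" "t k = b" "\<forall>i<k. t i < t (Suc i)" for k and t :: "nat \<Rightarrow> real"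
  proof -
    have mono: "t l \<le> t m" if "l \<le> m" "m \<le> k" for l m
      using that
    proof (induction m rule: dec_induct)
      case (step m)
      then show ?case using t(3) by (meson Suc_le_lessD less_imp_le_nat less_eq_real_def order_trans)
    qed simp
    have "(\<Sum>i=1..m. d (\<gamma> (t (i - 1))) (\<gamma> (t i))) \<le> v (t m) - v (t 0)" if "m \<le> k" for m
      using that
    proof (induction m)
      case (Suc m)
      have "d (\<gamma> (t m)) (\<gamma> (t (Suc m))) \<le> v (t (Suc m)) - v (t m)"
        using mono[of 0 m] mono[of m "Suc m"] mono[of "Suc m" k] Suc.prems t(1,2)
        by (intro length_controlD[OF v]) auto
      then show ?case using Suc by simp
    qed simp
    from this[of k] show ?thesis by (simp add: t)
  qed
  then show ?thesis unfolding path_length_def by (intro SUP_least) auto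
qed

text \<open>Every subdivision of \<open>{a..s}\<close> extends by the point \<open>t\<close> to one of \<open>{a..t}\<close>. This makes the length
  of the initial piece of a path a control function.\<close>
lemma path_length_extend:
  assumes "s < t"
  shows "path_length a s \<gamma> + ereal (d (\<gamma> s) (\<gamma> t)) \<le> path_length a t \<gamma>"
proof -
  have "ereal (\<Sum>i=1..k. d (\<gamma> (u (i - 1))) (\<gamma> (u i))) \<le> path_length a t \<gamma> - ereal (d (\<gamma> s) (\<gamma> t))"
    if u: "u 0 = a" "u k = s" "\<forall>i<k. u i < u (Suc i)" for k and u :: "nat \<Rightarrow> real"
  proof -
    define u' where "u' = u(Suc k := t)"
    have eq: "(\<Sum>i=1..k. d (\<gamma> (u' (i - 1))) (\<gamma> (u' i))) = (\<Sum>i=1..k. d (\<gamma> (u (i - 1))) (\<gamma> (u i)))"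
      by (rule sum.cong) (auto simp: u'_def)
    have "ereal (\<Sum>i=1..Suc k. d (\<gamma> (u' (i - 1))) (\<gamma> (u' i))) \<le> path_length a t \<gamma>"
      unfolding path_length_def
      using u assms by (intro SUP_upper2[of "(Suc k, u')"]) (auto simp: u'_def less_Suc_eq)
    moreover have "(\<Sum>i=1..Suc k. d (\<gamma> (u' (i - 1))) (\<gamma> (u' i))) =
        (\<Sum>i=1..k. d (\<gamma> (u (i - 1))) (\<gamma> (u i))) + d (\<gamma> s) (\<gamma> t)"
      using eq u(2) by (simp add: u'_def)
    ultimately show ?thesis by (simp add: ereal_le_minus)
  qed
  then have "path_length a s \<gamma> \<le> path_length a t \<gamma> - ereal (d (\<gamma> s) (\<gamma> t))"
    unfolding path_length_def[of a s] by (intro SUP_least) auto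
  then show ?thesis by (simp add: ereal_le_minus)
qed

lemma path_length_control_exists:
  assumes M: "\<And>t. a \<le> t \<Longrightarrow> t \<le> b \<Longrightarrow> \<gamma> t \<in> M"
    and "a \<le> b" and A: "path_length a b \<gamma> \<le> ereal A"
  obtains v where "length_control a b \<gamma> v" "v b - v a \<le> A"
proof -
  define v where "v t = real_of_ereal (path_length a t \<gamma>)" for t
  have ext: "path_length a s \<gamma> + ereal (d (\<gamma> s) (\<gamma> t)) \<le> path_length a t \<gamma>"
    if "a \<le> s" "s \<le> t" "t \<le> b" for s t
    using path_length_extend[of s t a \<gamma>] that M[of s] by (cases "s = t") auto
  have mono: "path_length a s \<gamma> \<le> path_length a t \<gamma>" if "a \<le> s" "s \<le> t" "t \<le> b" for s t
    using add_increasing2[of "ereal (d (\<gamma> s) (\<gamma> t))" "path_length a s \<gamma>" "path_length a s \<gamma>"]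
      ext[OF that] by (metis ereal_less_eq(5) nonneg order_refl order_trans)
  have "0 \<le> path_length a a \<gamma>"
    unfolding path_length_def by (intro SUP_upper2[of "(0, \<lambda>_. a)"]) auto
  then have pos: "0 \<le> path_length a t \<gamma>" if "a \<le> t" "t \<le> b" for t
    using mono[of a t] that by auto
  have v: "path_length a t \<gamma> = ereal (v t)" if "a \<le> t" "t \<le> b" for t
  proof -
    have "path_length a t \<gamma> \<le> ereal A" using mono[of t b] that A by auto
    with pos[OF that] show ?thesis by (cases "path_length a t \<gamma>") (auto simp: v_def)
  qed
  show thesis
  proof
    show "length_control a b \<gamma> v"
      unfolding length_control_def
    proof (intro allI impI)
      fix s t assume "a \<le> s" "s \<le> t" "t \<le> b"
      then show "d (\<gamma> s) (\<gamma> t) \<le> v t - v s" using ext[of s t] v[of s] v[of t] by auto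
    qed
    show "v b - v a \<le> A" using v[of a] v[of b] pos[of a] A \<open>a \<le> b\<close> by auto
  qed
qed

section \<open>The intrinsic distance\<close>

lemma connects_in_M: "connects a b \<gamma> x y \<Longrightarrow> a \<le> t \<Longrightarrow> t \<le> b \<Longrightarrow> \<gamma> t \<in> M"
  by (auto simp: connects_def continuous_map_def)

lemma intrinsic_dist_le_control:
  assumes "connects a b \<gamma> x y" "length_control a b \<gamma> v"
  shows "intrinsic_dist x y \<le> ereal (v b - v a)"
  unfolding intrinsic_dist_def using assms path_length_le_control
  by (intro INF_lower2[of "(a, b, \<gamma>)"]) auto

lemma intrinsic_dist_lessE:
  assumes "intrinsic_dist x y < ereal A"
  obtains a b \<gamma> v where "connects a b \<gamma> x y" "length_control a b \<gamma> v" "v b - v a \<le> A"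
proof -
  obtain a b \<gamma> where c: "connects a b \<gamma> x y" and l: "path_length a b \<gamma> < ereal A"
    using assms unfolding intrinsic_dist_def by (auto simp: INF_less_iff)
  have "a \<le> b" using c by (simp add: connects_def)
  then obtain v where "length_control a b \<gamma> v" "v b - v a \<le> A"
    using path_length_control_exists[OF connects_in_M[OF c] _ less_imp_le[OF l]] by blast
  then show thesis using c that by blast
qed

lemma intrinsic_dist_nonneg: "0 \<le> intrinsic_dist x y"
proof (rule ccontr)
  assume "\<not> 0 \<le> intrinsic_dist x y"
  then obtain A where A: "intrinsic_dist x y < ereal A" "ereal A < 0"
    using ereal_dense2 by (metis linorder_not_le)
  from A(1) obtain a b \<gamma> v where "connects a b \<gamma> x y" "length_control a b \<gamma> v" "v b - v a \<le> A"
    by (rule intrinsic_dist_lessE)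
  then have "d (\<gamma> a) (\<gamma> b) \<le> A" by (force simp: connects_def dest: length_controlD)
  with A(2) show False using nonneg[of "\<gamma> a" "\<gamma> b"] by auto
qed

lemma connects_join:
  assumes 1: "connects a b \<gamma> x y" and 2: "connects a' b' \<gamma>' y z"
  shows "connects a (b + (b' - a')) (\<lambda>t. if t \<le> b then \<gamma> t else \<gamma>' (t - b + a')) x z"
proof -
  let ?X = "top_of_set {a..b + (b' - a')}"
  have c: "continuous_map (top_of_set {a..b}) mtopology \<gamma>"
    "continuous_map (top_of_set {a'..b'}) mtopology \<gamma>'"
    and e: "a \<le> b" "a' \<le> b'" "\<gamma> a = x" "\<gamma> b = y" "\<gamma>' a' = y" "\<gamma>' b' = z"
    using 1 2 by (auto simp: connects_def)
  have "continuous_map ?X mtopology (\<lambda>t. if t \<le> b then \<gamma> t else \<gamma>' (t - b + a'))"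
  proof (rule continuous_map_cases_le)
    show "continuous_map ?X euclideanreal (\<lambda>t. t)" "continuous_map ?X euclideanreal (\<lambda>t. b)"
      by (auto intro: continuous_intros)
    show "continuous_map (subtopology ?X {t \<in> topspace ?X. t \<le> b}) mtopology \<gamma>"
      unfolding subtopology_subtopology
      by (rule continuous_map_from_subtopology_mono[OF c(1)]) (use e in auto)
    have "continuous_map (subtopology ?X {t \<in> topspace ?X. b \<le> t}) (top_of_set {a'..b'}) (\<lambda>t. t - b + a')"
      using e by (auto simp: continuous_map_in_subtopology subtopology_subtopology intro!: continuous_intros)
    from continuous_map_compose[OF this c(2)]
    show "continuous_map (subtopology ?X {t \<in> topspace ?X. b \<le> t}) mtopology (\<lambda>t. \<gamma>' (t - b + a'))"
      by (simp add: o_def)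
  qed (use e in auto)
  then show ?thesis using e unfolding connects_def by auto
qed

lemma length_control_join:
  assumes 1: "connects a b \<gamma> x y" "length_control a b \<gamma> v"
    and 2: "connects a' b' \<gamma>' y z" "length_control a' b' \<gamma>' v'"
  shows "length_control a (b + (b' - a')) (\<lambda>t. if t \<le> b then \<gamma> t else \<gamma>' (t - b + a'))
    (\<lambda>t. if t \<le> b then v t else v b + (v' (t - b + a') - v' a'))"
  unfolding length_control_def
proof (intro allI impI)
  fix s t assume st: "a \<le> s" "s \<le> t" "t \<le> b + (b' - a')"
  have e: "a \<le> b" "a' \<le> b'" "\<gamma> b = y" "\<gamma>' a' = y" using 1(1) 2(1) by (auto simp: connects_def)
  have mid: "d (\<gamma> s) (\<gamma>' (t - b + a')) \<le> (v b - v s) + (v' (t - b + a') - v' a')"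
    if "s \<le> b" "b < t"
  proof -
    have "d (\<gamma> s) (\<gamma>' (t - b + a')) \<le> d (\<gamma> s) y + d y (\<gamma>' (t - b + a'))"
      using connects_in_M[OF 1(1), of s] connects_in_M[OF 1(1), of b]
        connects_in_M[OF 2(1), of "t - b + a'"] st that e by (intro triangle) auto
    moreover have "d (\<gamma> s) y \<le> v b - v s"
      using length_controlD[OF 1(2), of s b] st that e by auto
    moreover have "d y (\<gamma>' (t - b + a')) \<le> v' (t - b + a') - v' a'"
      using length_controlD[OF 2(2), of a' "t - b + a'"] st that e by auto
    ultimately show ?thesis by linarith
  qed
  consider "t \<le> b" | "b < s" | "s \<le> b" "b < t" by linarith
  then show "d (if s \<le> b then \<gamma> s else \<gamma>' (s - b + a')) (if t \<le> b then \<gamma> t else \<gamma>' (t - b + a'))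
      \<le> (if t \<le> b then v t else v b + (v' (t - b + a') - v' a')) -
        (if s \<le> b then v s else v b + (v' (s - b + a') - v' a'))"
  proof cases
    case 1
    then show ?thesis using length_controlD[OF assms(2), of s t] st by auto
  next
    case 2
    then show ?thesis
      using length_controlD[OF assms(4), of "s - b + a'" "t - b + a'"] st by auto
  next
    case 3
    then show ?thesis using mid by auto
  qed
qed

text \<open>Almost shortest paths and their control functions are joined end to end.\<close>
lemma intrinsic_dist_triangle:
  assumes "intrinsic_dist x y \<le> ereal A" "intrinsic_dist y z \<le> ereal B"
  shows "intrinsic_dist x z \<le> ereal (A + B)"
proof (rule ereal_le_epsilon2)
  fix e :: real assume "0 < e"
  then have "intrinsic_dist x y < ereal (A + e/2)" "intrinsic_dist y z < ereal (B + e/2)"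
    using assms by (auto intro: le_less_trans)
  then obtain a b \<gamma> v a' b' \<gamma>' v' where
    1: "connects a b \<gamma> x y" "length_control a b \<gamma> v" "v b - v a \<le> A + e/2" and
    2: "connects a' b' \<gamma>' y z" "length_control a' b' \<gamma>' v'" "v' b' - v' a' \<le> B + e/2"
    by (elim intrinsic_dist_lessE)
  have "a \<le> b" "a' \<le> b'" using 1 2 by (auto simp: connects_def)
  with intrinsic_dist_le_control[OF connects_join[OF 1(1) 2(1)] length_control_join[OF 1(1,2) 2(1,2)]]
  have "intrinsic_dist x z \<le> ereal ((v b - v a) + (v' b' - v' a'))"
    by (cases "b' = a'") (auto simp: algebra_simps)
  also have "\<dots> \<le> ereal (A + B + e)" using 1(3) 2(3) by simp
  finally show "intrinsic_dist x z \<le> ereal (A + B) + ereal e" by simp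
qed

text \<open>Cover the space by open sets \<open>U\<close> on whose square \<open>\<omega> < c\<close>. A Lebesgue number of this cover for
  the compact ball of radius \<open>R\<close> gives the uniform radius \<open>\<rho>\<close>: if \<open>x\<close> is close to a point \<open>y\<close> of the ball,
  one such \<open>U\<close> contains both.\<close>
lemma small_near_diagonal:
  fixes \<omega> :: "'a \<Rightarrow> 'a \<Rightarrow> 'b::order_topology"
  assumes "proper_space"
    and cont: "continuous_map (prod_topology mtopology mtopology) euclidean (\<lambda>(x, y). \<omega> x y)"
    and diag: "\<And>x. x \<in> M \<Longrightarrow> \<omega> x x < c"
    and z: "z \<in> M"
  obtains \<rho> where "0 < \<rho>"
    "\<And>x y. x \<in> M \<Longrightarrow> y \<in> M \<Longrightarrow> d z y \<le> R \<Longrightarrow> d x y \<le> \<rho> \<Longrightarrow> \<omega> x y < c"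
proof -
  let ?S = "{p \<in> topspace (prod_topology mtopology mtopology). (case p of (x, y) \<Rightarrow> \<omega> x y) \<in> {..<c}}"
  define \<C> where "\<C> = {U. openin mtopology U \<and> U \<times> U \<subseteq> ?S}"
  have S: "openin (prod_topology mtopology mtopology) ?S"
    using cont by (rule openin_continuous_map_preimage) simp
  have "M \<subseteq> \<Union>\<C>"
  proof
    fix x assume x: "x \<in> M"
    then have "(x, x) \<in> ?S" using diag by auto
    then obtain U V where "openin mtopology U" "openin mtopology V" "x \<in> U" "x \<in> V" "U \<times> V \<subseteq> ?S"
      using S unfolding openin_prod_topology_alt by meson
    then have "U \<inter> V \<in> \<C>" "x \<in> U \<inter> V" unfolding \<C>_def by auto
    then show "x \<in> \<Union>\<C>" by blast
  qed
  then have "mcball z R \<subseteq> \<Union>\<C>" using mcball_subset_mspace by blast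
  moreover have "compactin mtopology (mcball z R)" using assms(1) z by (simp add: proper_space_def)
  ultimately obtain \<epsilon> where \<epsilon>: "\<epsilon> > 0" "\<forall>y\<in>mcball z R. \<exists>U\<in>\<C>. mball y \<epsilon> \<subseteq> U"
    using lebesgue_number[of "mcball z R" \<C>] unfolding \<C>_def by blast
  show thesis
  proof (rule that[of "\<epsilon>/2"])
    show "0 < \<epsilon>/2" using \<epsilon> by simp
    fix x y assume xy: "x \<in> M" "y \<in> M" "d z y \<le> R" "d x y \<le> \<epsilon>/2"
    then have "y \<in> mcball z R" using z by simp
    then obtain U where U: "U \<in> \<C>" "mball y \<epsilon> \<subseteq> U" using \<epsilon>(2) by blast
    have "x \<in> U" "y \<in> U" using U(2) xy \<epsilon>(1) commute[of x y] by (auto simp: subset_iff)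
    then show "\<omega> x y < c" using U(1) unfolding \<C>_def by auto
  qed
qed

lemma continuous_on_dist_path:
  assumes "continuous_map (top_of_set S) mtopology \<gamma>" "x \<in> M"
  shows "continuous_on S (\<lambda>s. d x (\<gamma> s))"
  using continuous_map_mdist[of "top_of_set S" "metric (M, d)" "\<lambda>_. x" \<gamma>] assms
  by (simp add: mtopology_of_def)

end

section \<open>Measurability\<close>

lemma neighborhood_graph_simps [simp]:
  "verts (neighborhood_graph n W r) = {1..n}"
  "tail (neighborhood_graph n W r) = fst" "head (neighborhood_graph n W r) = snd"
  by (simp_all add: neighborhood_graph_def)

lemma arcs_neighborhood_graph [simp]:
  "(k, l) \<in> arcs (neighborhood_graph n W r) \<longleftrightarrow> k \<in> {1..n} \<and> l \<in> {1..n} \<and> W k l \<le> r"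
  by (simp add: neighborhood_graph_def)

text \<open>The set of walks over which the infimum is taken depends on the random weights. It becomes a fixed
  countable set if one takes all walks of the complete graph and gives the cost \<open>\<infinity>\<close> to those that use an
  arc longer than \<open>r\<close>.\<close>
lemma borel_measurable_graph_dist:
  fixes W :: "'w \<Rightarrow> nat \<Rightarrow> nat \<Rightarrow> real"
  assumes meas: "\<And>k l. k \<in> {1..n} \<Longrightarrow> l \<in> {1..n} \<Longrightarrow> (\<lambda>w. W w k l) \<in> borel_measurable N"
  shows "(\<lambda>w. graph_dist n (W w) r i j) \<in> borel_measurable N"
proof -
  \<comment> \<open>With all weights and the radius equal to 0, every pair of nodes is an arc.\<close>
  let ?K = "neighborhood_graph n (\<lambda>_ _. 0) 0"
  have cas: "pre_digraph.cas (neighborhood_graph n V s) u p v \<longleftrightarrow> pre_digraph.cas ?K u p v"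
    for V s u p v
    by (induction p arbitrary: u) (simp_all add: pre_digraph.cas.simps)
  have walk: "pre_digraph.awalk (neighborhood_graph n V r) i p j \<longleftrightarrow>
      pre_digraph.awalk ?K i p j \<and> (\<forall>(k, l)\<in>set p. V k l \<le> r)" for V p
    unfolding pre_digraph.awalk_def cas[of V] by (auto simp: subset_iff)
  have eq: "graph_dist n V r i j = (INF p \<in> {p. pre_digraph.awalk ?K i p j}.
      if \<forall>(k, l)\<in>set p. V k l \<le> r then ereal (\<Sum>(k, l)\<leftarrow>p. V k l) else \<infinity>)" (is "?l = ?r") for V
  proof (rule antisym)
    have d: "graph_dist n V r i j = (INF p \<in> {p. pre_digraph.awalk (neighborhood_graph n V r) i p j}.
        ereal (\<Sum>(k, l)\<leftarrow>p. V k l))"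
      unfolding graph_dist_def wf_digraph.\<mu>_def[OF wf_neighborhood_graph]
        wf_digraph.awalk_cost_def[OF wf_neighborhood_graph] ..
    show "?l \<le> ?r" unfolding d by (intro INF_greatest) (auto simp: walk intro: INF_lower)
    show "?r \<le> ?l" unfolding d
    proof (rule INF_greatest)
      fix p assume "p \<in> {p. pre_digraph.awalk (neighborhood_graph n V r) i p j}"
      then show "?r \<le> ereal (\<Sum>(k, l)\<leftarrow>p. V k l)" by (intro INF_lower2[of p]) (auto simp: walk)
    qed
  qed
  show ?thesis unfolding eq
  proof (rule borel_measurable_INF)
    fix p assume "p \<in> {p. pre_digraph.awalk ?K i p j}"
    then have "set p \<subseteq> {1..n} \<times> {1..n}" by (auto simp: pre_digraph.awalk_def)
    then have "(\<lambda>w. \<Sum>(k, l)\<leftarrow>p. W w k l) \<in> borel_measurable N \<and>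
        Measurable.pred N (\<lambda>w. \<forall>(k, l)\<in>set p. W w k l \<le> r)"
    proof (induction p)
      case (Cons e p)
      obtain k l where e: "e = (k, l)" by fastforce
      have [measurable]: "(\<lambda>w. W w k l) \<in> borel_measurable N" using Cons.prems e by (auto intro: meas)
      have [measurable]: "(\<lambda>w. \<Sum>(k, l)\<leftarrow>p. W w k l) \<in> borel_measurable N"
        "Measurable.pred N (\<lambda>w. \<forall>(k, l)\<in>set p. W w k l \<le> r)" using Cons by auto
      show ?case unfolding e by simp
    qed simp
    then have [measurable]: "(\<lambda>w. \<Sum>(k, l)\<leftarrow>p. W w k l) \<in> borel_measurable N"
        "Measurable.pred N (\<lambda>w. \<forall>(k, l)\<in>set p. W w k l \<le> r)" by auto
    show "(\<lambda>w. if \<forall>(k, l)\<in>set p. W w k l \<le> r then ereal (\<Sum>(k, l)\<leftarrow>p. W w k l) else \<infinity>)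
        \<in> borel_measurable N" by measurable
  qed simp
qed

lemma sample_statistic_measurable:
  assumes "\<And>l k. (l, k) \<in> sample_index m n \<Longrightarrow> X n l k \<in> measurable N borel"
    and "f \<in> borel_measurable (PiM (sample_index m n) (\<lambda>_. borel))"
  shows "(\<lambda>w. f (sample_data m X n w)) \<in> borel_measurable N"
proof -
  have "sample_data m X n \<in> measurable N (PiM (sample_index m n) (\<lambda>_. borel))"
    unfolding sample_data_def by (rule measurable_restrict) (use assms(1) in auto)
  from measurable_compose[OF this assms(2)] show ?thesis .
qed

section \<open>Walks in the neighborhood graph and paths in the space\<close>

text \<open>The situation on the event that the estimates are accurate. The value of \<open>W k k\<close> is
  arbitrary up to its sign: dropping a loop from a walk never increases the cost.\<close>
locale estimated_distances = Metric_space M d for M :: "'a set" and d +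
  fixes q :: "nat \<Rightarrow> 'a" and n :: nat and W :: "nat \<Rightarrow> nat \<Rightarrow> real" and \<eta> :: real
  assumes q_in: "k \<in> {1..n} \<Longrightarrow> q k \<in> M"
    and W_nonneg: "k \<in> {1..n} \<Longrightarrow> l \<in> {1..n} \<Longrightarrow> 0 \<le> W k l"
    and W_close: "k \<in> {1..n} \<Longrightarrow> l \<in> {1..n} \<Longrightarrow> k \<noteq> l \<Longrightarrow>
      \<bar>W k l - d (q k) (q l)\<bar> \<le> \<eta> * d (q k) (q l)"
    and \<eta>_bounds: "0 \<le> \<eta>" "\<eta> < 1"
begin

lemma W_le: "k \<in> {1..n} \<Longrightarrow> l \<in> {1..n} \<Longrightarrow> k \<noteq> l \<Longrightarrow> W k l \<le> (1 + \<eta>) * d (q k) (q l)"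
  using W_close[of k l] by (auto simp: algebra_simps)

lemma W_ge: "k \<in> {1..n} \<Longrightarrow> l \<in> {1..n} \<Longrightarrow> (1 - \<eta>) * d (q k) (q l) \<le> W k l"
  using W_close[of k l] W_nonneg[of k l] q_in[of k] by (cases "k = l") (auto simp: algebra_simps)

text \<open>By induction on \<open>m\<close>, follow the path from a point \<open>q k\<close> near \<open>\<gamma> t\<close>. If the end of the path is
  within \<open>\<rho>\<close> of \<open>\<gamma> t\<close>, one arc suffices. Otherwise the intermediate value theorem gives a later time
  \<open>s\<close> at which the path is at distance exactly \<open>\<rho>\<close> from \<open>\<gamma> t\<close>; between these times \<open>v\<close> increases by at least
  \<open>\<rho>\<close>, which uses up one of the \<open>m\<close> steps, and the walk goes on from one of the points \<open>q l\<close> near \<open>\<gamma> s\<close>.\<close>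
lemma walk_along_path:
  assumes net: "\<And>x. x \<in> M \<Longrightarrow> \<exists>k\<in>{1..n}. d x (q k) \<le> \<epsilon>"
    and \<epsilon>: "0 \<le> \<epsilon>" and r\<epsilon>: "(1 + \<eta>) * (\<rho> + 2 * \<epsilon>) \<le> r" and \<rho>: "0 < \<rho>"
    and j: "j \<in> {1..n}"
    and \<gamma>: "continuous_map (top_of_set {a..b}) mtopology \<gamma>" "\<gamma> b = q j"
    and v: "length_control a b \<gamma> v"
    and t: "a \<le> t" "t \<le> b" and k: "k \<in> {1..n}" "d (q k) (\<gamma> t) \<le> \<epsilon>"
    and len: "v b - v t \<le> real m * \<rho>"
  shows "graph_dist n W r k j \<le> ereal ((1 + \<eta>) * (v b - v t + 2 * \<epsilon> * (real m + 1)))"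
proof -
  interpret G: wf_digraph "neighborhood_graph n W r" by (rule wf_neighborhood_graph)
  have inM: "\<gamma> s \<in> M" if "a \<le> s" "s \<le> b" for s
    using \<gamma>(1) that by (auto simp: continuous_map_def)
  \<comment> \<open>Prepending an arc to a walk. Nearby points of the path may have the same nearest node; then
    no arc is taken.\<close>
  have step: "\<exists>p. G.awalk k p j \<and> G.awalk_cost (\<lambda>(k, l). W k l) p \<le> (1 + \<eta>) * D + C"
    if kl: "k \<in> {1..n}" "l \<in> {1..n}" "d (q k) (q l) \<le> D" "D \<le> \<rho> + 2 * \<epsilon>"
      and p: "G.awalk l p j" "G.awalk_cost (\<lambda>(k, l). W k l) p \<le> C" for k l p D C
  proof (cases "k = l")
    case True
    then have "0 \<le> D" using kl(3) nonneg[of "q k" "q l"] by linarith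
    then have "0 \<le> (1 + \<eta>) * D" using \<eta>_bounds by simp
    then show ?thesis using True p by (intro exI[of _ p]) auto
  next
    case False
    have "W k l \<le> (1 + \<eta>) * d (q k) (q l)" using W_le kl False by blast
    also have "\<dots> \<le> (1 + \<eta>) * D" using kl(3) \<eta>_bounds by (intro mult_left_mono) auto
    finally have 1: "W k l \<le> (1 + \<eta>) * D" .
    also have "\<dots> \<le> (1 + \<eta>) * (\<rho> + 2 * \<epsilon>)" using kl(4) \<eta>_bounds by (intro mult_left_mono) auto
    finally have "W k l \<le> r" using r\<epsilon> by linarith
    then have "G.awalk k ((k, l) # p) j" using p kl by (simp add: G.awalk_Cons_iff)
    then show ?thesis using p 1 by (intro exI[of _ "(k, l) # p"]) auto
  qed
  have "\<exists>p. G.awalk k p j \<and>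
      G.awalk_cost (\<lambda>(k, l). W k l) p \<le> (1 + \<eta>) * (v b - v t + 2 * \<epsilon> * (real m + 1))"
    using t k len
  proof (induction m arbitrary: t k)
    case (0 t k)
    have "d (\<gamma> t) (\<gamma> b) \<le> v b - v t" using length_controlD[OF v] 0 by auto
    moreover have "d (q k) (q j) \<le> d (q k) (\<gamma> t) + d (\<gamma> t) (\<gamma> b)"
      using triangle[of "q k" "\<gamma> t" "\<gamma> b"] 0 q_in inM \<gamma>(2) j by auto
    ultimately have "d (q k) (q j) \<le> v b - v t + 2 * \<epsilon>" using 0 \<epsilon> by simp
    then show ?case
      using step[of k j "v b - v t + 2 * \<epsilon>" "[]" 0] 0 j \<rho> by (auto simp: G.awalk_Nil_iff)
  next
    case (Suc m t k)
    show ?case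
    proof (cases "d (\<gamma> t) (\<gamma> b) \<le> \<rho>")
      case True
      have "d (\<gamma> t) (\<gamma> b) \<le> v b - v t" using length_controlD[OF v] Suc by auto
      moreover have "d (q k) (q j) \<le> d (q k) (\<gamma> t) + d (\<gamma> t) (\<gamma> b)"
        using triangle[of "q k" "\<gamma> t" "\<gamma> b"] Suc.prems q_in inM \<gamma>(2) j by auto
      ultimately obtain p where p: "G.awalk k p j"
        "G.awalk_cost (\<lambda>(k, l). W k l) p \<le> (1 + \<eta>) * (d (\<gamma> t) (\<gamma> b) + 2 * \<epsilon>) + 0"
        using step[of k j "d (\<gamma> t) (\<gamma> b) + 2 * \<epsilon>" "[]" 0] Suc.prems j True \<epsilon>
        by (auto simp: G.awalk_Nil_iff)
      have "d (\<gamma> t) (\<gamma> b) + 2 * \<epsilon> \<le> v b - v t + 2 * \<epsilon> * (real (Suc m) + 1)"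
        using \<open>d (\<gamma> t) (\<gamma> b) \<le> v b - v t\<close> \<epsilon> mult_left_mono[of 1 "real (Suc m) + 1" "2 * \<epsilon>"] by linarith
      then have "(1 + \<eta>) * (d (\<gamma> t) (\<gamma> b) + 2 * \<epsilon>) \<le> (1 + \<eta>) * (v b - v t + 2 * \<epsilon> * (real (Suc m) + 1))"
        using \<eta>_bounds by (intro mult_left_mono) auto
      then show ?thesis using p by (intro exI[of _ p]) auto
    next
      case False
      have "continuous_on {a..b} (\<lambda>s. d (\<gamma> t) (\<gamma> s))"
        using continuous_on_dist_path \<gamma>(1) inM Suc.prems by auto
      then have "continuous_on {t..b} (\<lambda>s. d (\<gamma> t) (\<gamma> s))"
        by (rule continuous_on_subset) (use Suc.prems in auto)
      then obtain s where s: "t \<le> s" "s \<le> b" "d (\<gamma> t) (\<gamma> s) = \<rho>"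
        using IVT'[of "\<lambda>s. d (\<gamma> t) (\<gamma> s)" t \<rho> b] False Suc.prems inM[of t] \<rho> by auto
      have \<rho>v: "\<rho> \<le> v s - v t" using length_controlD[OF v, of t s] s Suc.prems by auto
      obtain l where l: "l \<in> {1..n}" "d (\<gamma> s) (q l) \<le> \<epsilon>" using net[of "\<gamma> s"] inM s Suc.prems by auto
      have "v b - v s \<le> real m * \<rho>" using Suc.prems \<rho>v by (simp add: algebra_simps)
      then obtain p where p: "G.awalk l p j"
        "G.awalk_cost (\<lambda>(k, l). W k l) p \<le> (1 + \<eta>) * (v b - v s + 2 * \<epsilon> * (real m + 1))"
        using Suc.IH[of s l] l s Suc.prems commute[of "\<gamma> s"] by auto
      have "d (q k) (q l) \<le> d (q k) (\<gamma> t) + d (\<gamma> t) (\<gamma> s) + d (\<gamma> s) (q l)"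
        using triangle[of "q k" "\<gamma> t" "q l"] triangle[of "\<gamma> t" "\<gamma> s" "q l"] inM q_in Suc.prems s l
        by force
      then have "d (q k) (q l) \<le> \<rho> + 2 * \<epsilon>" using s l Suc.prems by simp
      from step[OF _ l(1) this _ p] obtain p' where p': "G.awalk k p' j"
        "G.awalk_cost (\<lambda>(k, l). W k l) p' \<le>
          (1 + \<eta>) * (\<rho> + 2 * \<epsilon>) + (1 + \<eta>) * (v b - v s + 2 * \<epsilon> * (real m + 1))"
        using Suc.prems by auto
      have "(1 + \<eta>) * (\<rho> + 2 * \<epsilon>) + (1 + \<eta>) * (v b - v s + 2 * \<epsilon> * (real m + 1)) =
          (1 + \<eta>) * (\<rho> + v b - v s + 2 * \<epsilon> * (real (Suc m) + 1))"
        by (simp add: algebra_simps)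
      also have "\<dots> \<le> (1 + \<eta>) * (v b - v t + 2 * \<epsilon> * (real (Suc m) + 1))"
        using \<eta>_bounds \<rho>v by (intro mult_left_mono) auto
      finally show ?thesis using p' by (intro exI[of _ p']) auto
    qed
  qed
  then obtain p where "G.awalk k p j"
    "G.awalk_cost (\<lambda>(k, l). W k l) p \<le> (1 + \<eta>) * (v b - v t + 2 * \<epsilon> * (real m + 1))" by blast
  then show ?thesis unfolding graph_dist_def using G.min_cost_le_walk_cost
    by (meson ereal_less_eq(3) order_trans)
qed

text \<open>The comparison of intrinsic and given distance is assumed only for arcs that lead to a point near
  the end \<open>q j\<close>. This is enough, since the rest of a walk of cost at most \<open>C\<close> from such a point to \<open>q j\<close>
  itself costs at most \<open>C\<close>; the induction carries this localization along.\<close>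
lemma intrinsic_dist_le_walk_cost:
  assumes j: "j \<in> {1..n}"
    and loc: "\<And>k l. k \<in> {1..n} \<Longrightarrow> l \<in> {1..n} \<Longrightarrow> W k l \<le> r \<Longrightarrow> (1 - \<eta>) * d (q j) (q l) \<le> C \<Longrightarrow>
      intrinsic_dist (q k) (q l) \<le> ereal ((1 + \<eta>) * d (q k) (q l))"
    and p: "pre_digraph.awalk (neighborhood_graph n W r) k p j"
      "wf_digraph.awalk_cost (\<lambda>(k, l). W k l) p \<le> C"
  shows "intrinsic_dist (q k) (q j) \<le>
    ereal ((1 + \<eta>) / (1 - \<eta>) * wf_digraph.awalk_cost (\<lambda>(k, l). W k l) p)"
proof -
  interpret G: wf_digraph "neighborhood_graph n W r" by (rule wf_neighborhood_graph)
  let ?c = "G.awalk_cost (\<lambda>(k, l). W k l)"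
  have "(1 - \<eta>) * d (q j) (q k) \<le> ?c p \<and> 0 \<le> ?c p \<and>
      intrinsic_dist (q k) (q j) \<le> ereal ((1 + \<eta>) / (1 - \<eta>) * ?c p)"
    using p
  proof (induction p arbitrary: k)
    case (Nil k)
    have "q j \<in> M" using q_in j by auto
    then have "intrinsic_dist (q j) (q j) \<le> ereal 0"
      using intrinsic_dist_le_control[of 0 0 "\<lambda>_. q j" "q j" "q j" "\<lambda>_. 0"]
      by (auto simp: connects_def length_control_def)
    then show ?case using Nil \<open>q j \<in> M\<close> by (auto simp: G.awalk_Nil_iff zero_ereal_def)
  next
    case (Cons e p k)
    obtain l where e: "e = (k, l)" and kl: "k \<in> {1..n}" "l \<in> {1..n}" "W k l \<le> r" and p: "G.awalk l p j"
      using Cons.prems by (cases e) (auto simp: G.awalk_Cons_iff)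
    have W: "0 \<le> W k l" "(1 - \<eta>) * d (q k) (q l) \<le> W k l" using W_nonneg W_ge kl by auto
    have cost: "?c (e # p) = W k l + ?c p" by (simp add: e)
    then have IH: "(1 - \<eta>) * d (q j) (q l) \<le> ?c p" "0 \<le> ?c p"
      "intrinsic_dist (q l) (q j) \<le> ereal ((1 + \<eta>) / (1 - \<eta>) * ?c p)"
      using Cons.IH[OF p] Cons.prems W by auto
    have "d (q j) (q k) \<le> d (q k) (q l) + d (q j) (q l)"
      using triangle[of "q j" "q l" "q k"] q_in kl j by (simp add: commute)
    then have "(1 - \<eta>) * d (q j) (q k) \<le> (1 - \<eta>) * (d (q k) (q l) + d (q j) (q l))"
      using \<eta>_bounds by (intro mult_left_mono) auto
    also have "\<dots> \<le> ?c (e # p)" using W IH cost by (simp add: algebra_simps)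
    finally have 1: "(1 - \<eta>) * d (q j) (q k) \<le> ?c (e # p)" .
    have "intrinsic_dist (q k) (q l) \<le> ereal ((1 + \<eta>) * d (q k) (q l))"
      using loc kl IH Cons.prems cost W by auto
    also have "(1 + \<eta>) * d (q k) (q l) = (1 + \<eta>) / (1 - \<eta>) * ((1 - \<eta>) * d (q k) (q l))"
      using \<eta>_bounds by simp
    also have "ereal \<dots> \<le> ereal ((1 + \<eta>) / (1 - \<eta>) * W k l)"
      using W \<eta>_bounds unfolding ereal_less_eq(3) by (intro mult_left_mono) auto
    finally have "intrinsic_dist (q k) (q j) \<le> ereal ((1 + \<eta>) / (1 - \<eta>) * W k l + (1 + \<eta>) / (1 - \<eta>) * ?c p)"
      using intrinsic_dist_triangle IH(3) by blast
    then show ?case using 1 cost IH(2) W(1) by (simp add: algebra_simps)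
  qed
  then show ?thesis by blast
qed

end


section \<open>Asymptotic comparison\<close>

context Metric_space
begin

lemma fill_radius_net:
  assumes "fill_radius q n < ereal \<epsilon>" "n \<ge> 1" "x \<in> M"
  shows "\<exists>k\<in>{1..n}. d x (q k) \<le> \<epsilon>"
proof -
  have "ereal (MIN k\<in>{1..n}. d x (q k)) \<le> fill_radius q n"
    unfolding fill_radius_def using assms by (intro SUP_upper)
  then have "(MIN k\<in>{1..n}. d x (q k)) < \<epsilon>"
    using assms(1) by (meson ereal_less(2) less_ereal.simps(1) order_le_less_trans)
  moreover have "(MIN k\<in>{1..n}. d x (q k)) \<in> (\<lambda>k. d x (q k)) ` {1..n}"
    using assms by (intro Min_in) auto
  ultimately show ?thesis by force
qed

text \<open>The path is cut at steps \<open>\<rho> = r/2\<close> and the net has radius \<open>\<epsilon> = \<eta> r\<close>. The bound \<open>\<eta> \<le> 1/8\<close> keeps the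
  estimated step length below \<open>r\<close>, as \<open>(9/8) (1/2 + 2/8) < 1\<close>.\<close>
lemma graph_dist_eventually_le:
  assumes q: "\<And>k. k \<ge> 1 \<Longrightarrow> q k \<in> M" and ij: "i \<ge> 1" "j \<ge> 1"
    and \<Lambda>: "intrinsic_dist (q i) (q j) < ereal \<Lambda>"
    and r: "\<And>n. r n > 0" "r \<longlonglongrightarrow> 0"
    and fill: "(\<lambda>n. fill_radius q n / ereal (r n)) \<longlonglongrightarrow> 0"
    and \<eta>: "0 < \<eta>" "\<eta> \<le> 1/8"
  shows "\<forall>\<^sub>F n in sequentially. \<forall>W. estimated_distances M d q n W \<eta> \<longrightarrow>
    graph_dist n W (r n) i j \<le> ereal (\<Lambda> + 9 * \<eta> * (\<Lambda> + 1))"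
proof -
  obtain a b \<gamma> v where c: "connects a b \<gamma> (q i) (q j)" and v: "length_control a b \<gamma> v" "v b - v a \<le> \<Lambda>"
    using \<Lambda> by (rule intrinsic_dist_lessE)
  have ab: "a \<le> b" "\<gamma> a = q i" "\<gamma> b = q j" "continuous_map (top_of_set {a..b}) mtopology \<gamma>"
    using c by (auto simp: connects_def)
  have \<Lambda>0: "0 \<le> \<Lambda>" using \<Lambda> intrinsic_dist_nonneg[of "q i" "q j"]
    by (metis ereal_less_eq(5) less_imp_le order_trans)
  have "\<forall>\<^sub>F n in sequentially. fill_radius q n / ereal (r n) < ereal \<eta>"
    using order_tendstoD(2)[OF fill, of "ereal \<eta>"] \<eta> by simp
  moreover have "\<forall>\<^sub>F n in sequentially. r n < 1" using order_tendstoD(2)[OF r(2), of 1] by simp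
  ultimately show ?thesis
    using eventually_ge_at_top[of i] eventually_ge_at_top[of j]
  proof (eventually_elim, intro allI impI)
    fix n W
    assume n: "fill_radius q n / ereal (r n) < ereal \<eta>" "r n < 1" "i \<le> n" "j \<le> n"
      and W: "estimated_distances M d q n W \<eta>"
    interpret estimated_distances M d q n W \<eta> by fact
    define m where "m = nat \<lceil>\<Lambda> / (r n / 2)\<rceil>"
    have "\<Lambda> / (r n / 2) \<le> real m" "real m \<le> \<Lambda> / (r n / 2) + 1"
      using \<Lambda>0 r(1)[of n] by (simp_all add: m_def)
    then have m: "\<Lambda> \<le> real m * (r n / 2)" "r n * (real m + 1) \<le> 2 * \<Lambda> + 2 * r n"
      using r(1)[of n] by (simp_all add: field_simps)
    have fr: "fill_radius q n < ereal (\<eta> * r n)"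
      using n(1) r(1)[of n] by (cases "fill_radius q n") (auto simp: field_simps)
    have "graph_dist n W (r n) i j \<le> ereal ((1 + \<eta>) * (v b - v a + 2 * (\<eta> * r n) * (real m + 1)))"
    proof (rule walk_along_path[where \<gamma> = \<gamma> and v = v and t = a and a = a and \<rho> = "r n / 2"])
      show "\<exists>k\<in>{1..n}. d x (q k) \<le> \<eta> * r n" if "x \<in> M" for x
        using fill_radius_net[OF fr _ that] n ij by simp
      show "(1 + \<eta>) * (r n / 2 + 2 * (\<eta> * r n)) \<le> r n"
      proof -
        have "(1 + \<eta>) * (1/2 + 2 * \<eta>) \<le> (9/8) * (6/8)" using \<eta> by (intro mult_mono) auto
        then have "(1 + \<eta>) * (1/2 + 2 * \<eta>) * r n \<le> 1 * r n"
          using r(1)[of n] by (intro mult_right_mono) auto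
        then show ?thesis by (simp add: algebra_simps)
      qed
      show "v b - v a \<le> real m * (r n / 2)" using m v by linarith
      show "d (q i) (\<gamma> a) \<le> \<eta> * r n" using ab q ij r(1)[of n] \<eta> by simp
    qed (use r(1)[of n] \<eta> n ij ab v(1) in auto)
    also have "(1 + \<eta>) * (v b - v a + 2 * (\<eta> * r n) * (real m + 1)) \<le> \<Lambda> + 9 * \<eta> * (\<Lambda> + 1)"
    proof -
      have "2 * \<eta> * (r n * (real m + 1)) \<le> 2 * \<eta> * (2 * \<Lambda> + 2)"
        using m n \<eta> by (intro mult_left_mono) auto
      then have "v b - v a + 2 * (\<eta> * r n) * (real m + 1) \<le> \<Lambda> + 4 * \<eta> * (\<Lambda> + 1)"
        using v by (simp add: algebra_simps)
      then have "(1 + \<eta>) * (v b - v a + 2 * (\<eta> * r n) * (real m + 1)) \<le> (1 + \<eta>) * (\<Lambda> + 4 * \<eta> * (\<Lambda> + 1))"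
        using \<eta> by (intro mult_left_mono) auto
      also have "\<dots> = \<Lambda> + \<eta> * (\<Lambda> + 4 * (\<Lambda> + 1) + \<eta> * (4 * (\<Lambda> + 1)))"
        by (simp add: algebra_simps)
      also have "\<dots> \<le> \<Lambda> + \<eta> * (\<Lambda> + 4 * (\<Lambda> + 1) + 1 * (4 * (\<Lambda> + 1)))"
        using \<eta> \<Lambda>0 by (intro add_left_mono mult_left_mono mult_right_mono) auto
      also have "\<dots> \<le> \<Lambda> + \<eta> * (9 * (\<Lambda> + 1))"
        using \<eta> \<Lambda>0 by (intro add_left_mono mult_left_mono) auto
      finally show ?thesis by (simp add: mult_ac)
    qed
    finally show "graph_dist n W (r n) i j \<le> ereal (\<Lambda> + 9 * \<eta> * (\<Lambda> + 1))" by simp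
  qed
qed

text \<open>A walk of cost above \<open>L\<close> needs no argument, so the walk may be assumed to stay in the ball of radius
  \<open>2 L\<close> about \<open>q j\<close>; there and for arcs of true length at most \<open>2 r\<close>, the function \<open>\<omega>\<close> is below \<open>\<eta>\<close> as
  soon as \<open>2 r\<close> is below the uniform radius. The factors 2 come from \<open>1 / (1 - \<eta>) \<le> 2\<close>.\<close>
lemma graph_dist_eventually_ge:
  assumes proper: "proper_space"
    and q: "\<And>k. k \<ge> 1 \<Longrightarrow> q k \<in> M" and j: "j \<ge> 1"
    and \<omega>: "\<And>x y. x \<in> M \<Longrightarrow> y \<in> M \<Longrightarrow> intrinsic_dist x y = ereal (d x y) * (1 + \<omega> x y)"
    and cont: "continuous_map (prod_topology mtopology mtopology) euclidean (\<lambda>(x, y). \<omega> x y)"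
    and diag: "\<And>x. x \<in> M \<Longrightarrow> \<omega> x x = 0"
    and L: "intrinsic_dist (q i) (q j) = ereal L"
    and r: "\<And>n. r n > 0" "r \<longlonglongrightarrow> 0"
    and \<eta>: "0 < \<eta>" "\<eta> \<le> 1/2"
  shows "\<forall>\<^sub>F n in sequentially. \<forall>W. estimated_distances M d q n W \<eta> \<longrightarrow>
    ereal (L - 2 * \<eta> * L) \<le> graph_dist n W (r n) i j"
proof -
  have L0: "0 \<le> L" using L intrinsic_dist_nonneg[of "q i" "q j"] by simp
  obtain \<rho> where \<rho>: "0 < \<rho>"
    and \<rho>\<omega>: "\<And>x y. x \<in> M \<Longrightarrow> y \<in> M \<Longrightarrow> d (q j) y \<le> 2 * L \<Longrightarrow> d x y \<le> \<rho> \<Longrightarrow> \<omega> x y < ereal \<eta>"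
    using small_near_diagonal[OF proper cont _ q[OF j], of "ereal \<eta>" "2 * L"] diag \<eta>(1) by auto
  have "\<forall>\<^sub>F n in sequentially. r n < \<rho> / 2" using order_tendstoD(2)[OF r(2), of "\<rho> / 2"] \<rho> by simp
  then show ?thesis using eventually_ge_at_top[of j]
  proof (eventually_elim, intro allI impI)
    fix n W
    assume n: "r n < \<rho> / 2" "j \<le> n" and W: "estimated_distances M d q n W \<eta>"
    interpret estimated_distances M d q n W \<eta> by fact
    interpret G: wf_digraph "neighborhood_graph n W (r n)" by (rule wf_neighborhood_graph)
    let ?c = "G.awalk_cost (\<lambda>(k, l). W k l)"
    have half: "x / 2 \<le> (1 - \<eta>) * x" if "0 \<le> x" for x
      using mult_right_mono[of "1/2" "1 - \<eta>" x] that \<eta> by simp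
    show "ereal (L - 2 * \<eta> * L) \<le> graph_dist n W (r n) i j"
      unfolding graph_dist_def G.\<mu>_def
    proof (rule INF_greatest)
      fix p assume "p \<in> {p. G.awalk i p j}"
      then have p: "G.awalk i p j" by simp
      show "ereal (L - 2 * \<eta> * L) \<le> ereal (?c p)"
      proof (cases "?c p \<le> L")
        case True
        have "intrinsic_dist (q i) (q j) \<le> ereal ((1 + \<eta>) / (1 - \<eta>) * ?c p)"
        proof (rule intrinsic_dist_le_walk_cost[OF _ _ p True])
          fix k l assume kl: "k \<in> {1..n}" "l \<in> {1..n}" "W k l \<le> r n" "(1 - \<eta>) * d (q j) (q l) \<le> L"
          have "d (q j) (q l) \<le> 2 * L" using half[of "d (q j) (q l)"] kl by simp
          moreover have "d (q k) (q l) \<le> \<rho>" using half[of "d (q k) (q l)"] W_ge[of k l] kl n by simp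
          ultimately have "1 + \<omega> (q k) (q l) \<le> ereal (1 + \<eta>)"
            using \<rho>\<omega>[of "q k" "q l"] q kl add_left_mono[of "\<omega> (q k) (q l)" "ereal \<eta>" 1]
            by (simp add: one_ereal_def)
          then have "ereal (d (q k) (q l)) * (1 + \<omega> (q k) (q l)) \<le> ereal (d (q k) (q l)) * ereal (1 + \<eta>)"
            by (intro ereal_mult_left_mono) auto
          then show "intrinsic_dist (q k) (q l) \<le> ereal ((1 + \<eta>) * d (q k) (q l))"
            using \<omega>[of "q k" "q l"] q kl by (simp add: mult.commute)
        qed (use n j in auto)
        then have "(1 - \<eta>) * L \<le> (1 + \<eta>) * ?c p" using L \<eta> by (simp add: field_simps)
        also have "\<dots> \<le> ?c p + \<eta> * L" using True \<eta> by (simp add: algebra_simps)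
        finally show ?thesis by (simp add: algebra_simps)
      next
        case False
        moreover have "0 \<le> \<eta> * L" using \<eta> L0 by simp
        ultimately show ?thesis by simp
      qed
    qed
  qed
qed

end

section \<open>Consistency\<close>

lemma max_rel_error_ge:
  assumes "k \<in> {1..n}" "l \<in> {1..n}" "k \<noteq> l"
  shows "\<bar>W k l - D k l\<bar> / D k l \<le> max_rel_error n W D"
proof -
  have "{\<bar>W k l - D k l\<bar> / D k l | k l. k \<in> {1..n} \<and> l \<in> {1..n} \<and> k \<noteq> l}
      \<subseteq> (\<lambda>(k, l). \<bar>W k l - D k l\<bar> / D k l) ` ({1..n} \<times> {1..n})" by auto
  then have "finite {\<bar>W k l - D k l\<bar> / D k l | k l. k \<in> {1..n} \<and> l \<in> {1..n} \<and> k \<noteq> l}"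
    by (rule finite_subset) simp
  then show ?thesis unfolding max_rel_error_def by (rule Max_ge) (use assms in blast)
qed

text \<open>For \<open>n\<close> large, the event that \<open>Z\<close> is off by more than \<open>e\<close> lies in the event that \<open>Y\<close> is off by more
  than \<open>h\<close>.\<close>
lemma tendsto_in_prob_transfer:
  assumes P: "\<And>n. prob_space (P n)"
    and Y: "tendsto_in_prob P Y c"
    and meas: "\<And>n. Z n \<in> borel_measurable (P n)"
    and dom: "\<And>e. 0 < e \<Longrightarrow> \<exists>h>0. \<forall>\<^sub>F n in sequentially. \<forall>w\<in>space (P n).
      \<bar>Y n w - c\<bar> \<le> ereal h \<longrightarrow> \<bar>Z n w - c'\<bar> \<le> ereal e"
  shows "tendsto_in_prob P Z c'"
  unfolding tendsto_in_prob_def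
proof (intro conjI allI impI meas)
  fix e :: real assume "0 < e"
  then obtain h where h: "0 < h" and ev: "\<forall>\<^sub>F n in sequentially. \<forall>w\<in>space (P n).
      \<bar>Y n w - c\<bar> \<le> ereal h \<longrightarrow> \<bar>Z n w - c'\<bar> \<le> ereal e" using dom by blast
  have "(\<lambda>n. measure (P n) {w \<in> space (P n). ereal h < \<bar>Y n w - c\<bar>}) \<longlonglongrightarrow> 0"
    using Y h by (auto simp: tendsto_in_prob_def)
  then show "(\<lambda>n. measure (P n) {w \<in> space (P n). ereal e < \<bar>Z n w - c'\<bar>}) \<longlonglongrightarrow> 0"
  proof (rule tendsto_sandwich[OF _ _ tendsto_const, rotated 2])
    show "\<forall>\<^sub>F n in sequentially. measure (P n) {w \<in> space (P n). ereal e < \<bar>Z n w - c'\<bar>}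
        \<le> measure (P n) {w \<in> space (P n). ereal h < \<bar>Y n w - c\<bar>}"
      using ev
    proof eventually_elim
      case (elim n)
      interpret prob_space "P n" by (rule P)
      have [measurable]: "Y n \<in> borel_measurable (P n)" using Y by (auto simp: tendsto_in_prob_def)
      show ?case by (rule finite_measure_mono) (use elim in \<open>auto simp: not_less[symmetric]\<close>)
    qed
  qed simp
qed

theorem proposition2p11:
  fixes \<mu> :: "(real ^ 'd) measure"
    and Q :: "(real ^ 'd \<Rightarrow> real) set"
    and \<delta> :: "(real ^ 'd \<Rightarrow> real) \<Rightarrow> (real ^ 'd \<Rightarrow> real) \<Rightarrow> real"
    and q :: "nat \<Rightarrow> real ^ 'd \<Rightarrow> real"
    and \<omega> :: "(real ^ 'd \<Rightarrow> real) \<Rightarrow> (real ^ 'd \<Rightarrow> real) \<Rightarrow> ereal"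
    and P :: "nat \<Rightarrow> 'w measure"
    and m :: "nat \<Rightarrow> nat \<Rightarrow> nat"
    and X :: "nat \<Rightarrow> nat \<Rightarrow> nat \<Rightarrow> 'w \<Rightarrow> real ^ 'd"
    and est :: "nat \<Rightarrow> nat \<Rightarrow> nat \<Rightarrow> (nat \<times> nat \<Rightarrow> real ^ 'd) \<Rightarrow> real"
    and \<delta>hat :: "nat \<Rightarrow> 'w \<Rightarrow> nat \<Rightarrow> nat \<Rightarrow> real"
    and r :: "nat \<Rightarrow> real"
    and i j :: nat
  assumes "sets \<mu> = sets borel"
    and "\<And>p. p \<in> Q \<Longrightarrow> prob_density \<mu> p"
    and "Metric_space Q \<delta>"
    and "Metric_space.proper_space Q \<delta>"
    and "\<And>l. l \<ge> 1 \<Longrightarrow> q l \<in> Q"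
    and "inj_on q {1..}"
    and "Metric_space.fill_radius Q \<delta> q \<longlonglongrightarrow> 0"
    and "\<And>x y. x \<in> Q \<Longrightarrow> y \<in> Q \<Longrightarrow>
           Metric_space.intrinsic_dist Q \<delta> x y = ereal (\<delta> x y) * (1 + \<omega> x y)"
    and "continuous_map
           (prod_topology (Metric_space.mtopology Q \<delta>) (Metric_space.mtopology Q \<delta>))
           euclidean (\<lambda>(x, y). \<omega> x y)"
    and "\<And>x. x \<in> Q \<Longrightarrow> \<omega> x x = 0"
    and "\<And>n. prob_space (P n)"
    and "\<And>n l. l \<in> {1..n} \<Longrightarrow> prob_space.indep_vars (P n) (\<lambda>_. borel) (X n l) {1..m n l}"
    and "\<And>n l k. l \<in> {1..n} \<Longrightarrow> k \<in> {1..m n l} \<Longrightarrow>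
           distributed (P n) \<mu> (X n l k) (\<lambda>x. ennreal (q l x))"
    and "filterlim (\<lambda>n. MIN l\<in>{1..n}. m n l) at_top sequentially"
    and "\<And>n k l. k \<in> {1..n} \<Longrightarrow> l \<in> {1..n} \<Longrightarrow>
           est n k l \<in> borel_measurable (PiM (sample_index m n) (\<lambda>_. borel))"
    and "\<And>n k l w. k \<in> {1..n} \<Longrightarrow> l \<in> {1..n} \<Longrightarrow> w \<in> space (P n) \<Longrightarrow>
           \<delta>hat n w k l = est n k l (sample_data m X n w)"
    and "\<And>n k l w. k \<in> {1..n} \<Longrightarrow> l \<in> {1..n} \<Longrightarrow> w \<in> space (P n) \<Longrightarrow> 0 \<le> \<delta>hat n w k l"
    and "\<And>n k l w. k \<in> {1..n} \<Longrightarrow> l \<in> {1..n} \<Longrightarrow> w \<in> space (P n) \<Longrightarrow>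
           \<delta>hat n w k l = \<delta>hat n w l k"
    and "tendsto_in_prob P
           (\<lambda>n w. ereal (max_rel_error n (\<delta>hat n w) (\<lambda>k l. \<delta> (q k) (q l)))) 0"
    and "i \<ge> 1" "j \<ge> 1"
    and "Metric_space.intrinsic_dist Q \<delta> (q i) (q j) < \<infinity>"
    and "\<And>n. r n > 0"
    and "r \<longlonglongrightarrow> 0"
    and "(\<lambda>n. Metric_space.fill_radius Q \<delta> q n / ereal (r n)) \<longlonglongrightarrow> 0"
  shows "tendsto_in_prob P (\<lambda>n w. graph_dist n (\<delta>hat n w) (r n) i j)
           (Metric_space.intrinsic_dist Q \<delta> (q i) (q j))"
proof (rule tendsto_in_prob_transfer[OF assms(11) assms(19)])
  interpret Metric_space Q \<delta> by fact
  fix n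
  have "(\<lambda>w. est n k l (sample_data m X n w)) \<in> borel_measurable (P n)" if "k \<in> {1..n}" "l \<in> {1..n}" for k l
  proof (rule sample_statistic_measurable[OF _ assms(15)[OF that]])
    fix l k assume "(l, k) \<in> sample_index m n"
    then have "X n l k \<in> measurable (P n) \<mu>"
      by (auto simp: sample_index_def intro!: distributed_measurable[OF assms(13)])
    then show "X n l k \<in> borel_measurable (P n)" using measurable_cong_sets[OF refl assms(1)] by blast
  qed
  then have "(\<lambda>w. \<delta>hat n w k l) \<in> borel_measurable (P n)" if "k \<in> {1..n}" "l \<in> {1..n}" for k l
    using that by (subst measurable_cong[OF assms(16)[OF that]]) auto
  then show "(\<lambda>w. graph_dist n (\<delta>hat n w) (r n) i j) \<in> borel_measurable (P n)"
    by (rule borel_measurable_graph_dist)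
next
  interpret Metric_space Q \<delta> by fact
  fix e :: real assume e: "0 < e"
  obtain L where L: "intrinsic_dist (q i) (q j) = ereal L"
    using assms(22) intrinsic_dist_nonneg[of "q i" "q j"] by (cases "intrinsic_dist (q i) (q j)") auto
  have L0: "0 \<le> L" using L intrinsic_dist_nonneg[of "q i" "q j"] by simp
  \<comment> \<open>The upper bound is used with \<open>\<Lambda> = L + e/2\<close>; with \<open>T = \<Lambda> + 1\<close>, its error term is \<open>9 \<eta> T \<le> e/2\<close>.\<close>
  define T where "T = L + e/2 + 1"
  define \<eta> where "\<eta> = min (1/8) (e / (18 * T))"
  have T: "T \<ge> 1" using L0 e by (simp add: T_def)
  have \<eta>: "0 < \<eta>" "\<eta> \<le> 1/8" "18 * \<eta> * T \<le> e"
    using T e by (auto simp: \<eta>_def min_def field_simps)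
  have "\<eta> * L \<le> \<eta> * T" using \<eta> e by (intro mult_left_mono) (auto simp: T_def)
  moreover have "0 \<le> \<eta> * T" using \<eta> T by simp
  ultimately have "9 * \<eta> * T \<le> e/2" "2 * \<eta> * L \<le> e" using \<eta>(3) by linarith+
  then have bounds: "L + e/2 + 9 * \<eta> * (L + e/2 + 1) \<le> L + e" "L - e \<le> L - 2 * \<eta> * L"
    by (auto simp: T_def[symmetric])
  have up: "\<forall>\<^sub>F n in sequentially. \<forall>W. estimated_distances Q \<delta> q n W \<eta> \<longrightarrow>
      graph_dist n W (r n) i j \<le> ereal (L + e/2 + 9 * \<eta> * (L + e/2 + 1))"
    by (rule graph_dist_eventually_le) (use assms(5,20,21,23-25) L e \<eta> in auto)
  have low: "\<forall>\<^sub>F n in sequentially. \<forall>W. estimated_distances Q \<delta> q n W \<eta> \<longrightarrow>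
      ereal (L - 2 * \<eta> * L) \<le> graph_dist n W (r n) i j"
    by (rule graph_dist_eventually_ge[OF assms(4) _ assms(21) assms(8-10) L assms(23,24)])
      (use assms(5) \<eta> in auto)
  show "\<exists>h>0. \<forall>\<^sub>F n in sequentially. \<forall>w\<in>space (P n).
      \<bar>ereal (max_rel_error n (\<delta>hat n w) (\<lambda>k l. \<delta> (q k) (q l))) - 0\<bar> \<le> ereal h \<longrightarrow>
      \<bar>graph_dist n (\<delta>hat n w) (r n) i j - intrinsic_dist (q i) (q j)\<bar> \<le> ereal e"
  proof (intro exI conjI)
    show "\<forall>\<^sub>F n in sequentially. \<forall>w\<in>space (P n).
        \<bar>ereal (max_rel_error n (\<delta>hat n w) (\<lambda>k l. \<delta> (q k) (q l))) - 0\<bar> \<le> ereal \<eta> \<longrightarrow>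
        \<bar>graph_dist n (\<delta>hat n w) (r n) i j - intrinsic_dist (q i) (q j)\<bar> \<le> ereal e"
      using up low
    proof (eventually_elim, intro ballI impI)
      fix n w
      assume up: "\<forall>W. estimated_distances Q \<delta> q n W \<eta> \<longrightarrow>
          graph_dist n W (r n) i j \<le> ereal (L + e/2 + 9 * \<eta> * (L + e/2 + 1))"
        and low: "\<forall>W. estimated_distances Q \<delta> q n W \<eta> \<longrightarrow>
          ereal (L - 2 * \<eta> * L) \<le> graph_dist n W (r n) i j"
        and w: "w \<in> space (P n)"
        and err: "\<bar>ereal (max_rel_error n (\<delta>hat n w) (\<lambda>k l. \<delta> (q k) (q l))) - 0\<bar> \<le> ereal \<eta>"
      have "estimated_distances Q \<delta> q n (\<delta>hat n w) \<eta>"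
      proof
        fix k l assume kl: "k \<in> {1..n}" "l \<in> {1..n}" "k \<noteq> l"
        have "q k \<noteq> q l" using inj_onD[OF assms(6), of k l] kl by auto
        then have "0 < \<delta> (q k) (q l)" using assms(5) kl by (simp add: mdist_pos_less)
        moreover have "\<bar>\<delta>hat n w k l - \<delta> (q k) (q l)\<bar> / \<delta> (q k) (q l) \<le> \<eta>"
          using max_rel_error_ge[OF kl, of "\<delta>hat n w" "\<lambda>k l. \<delta> (q k) (q l)"] err by simp
        ultimately show "\<bar>\<delta>hat n w k l - \<delta> (q k) (q l)\<bar> \<le> \<eta> * \<delta> (q k) (q l)"
          by (simp add: field_simps)
      qed (use assms(5,17) w \<eta> in auto)
      then have "graph_dist n (\<delta>hat n w) (r n) i j \<le> ereal (L + e)"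
        "ereal (L - e) \<le> graph_dist n (\<delta>hat n w) (r n) i j"
        using up low bounds by (meson ereal_less_eq(3) order_trans)+
      then show "\<bar>graph_dist n (\<delta>hat n w) (r n) i j - intrinsic_dist (q i) (q j)\<bar> \<le> ereal e"
        unfolding L by (cases "graph_dist n (\<delta>hat n w) (r n) i j") auto
    qed
  qed (rule \<eta>)
qed

end
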